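(* Let $n>2$, let $A\in\mathbb{R}^{n\times n}$ and $B\in\mathbb{R}^n$ be such that $\det([B,AB,\ldots,A^{n-1}B])\neq 0$ (so that the linear system $\dot x=Ax+Bw$ is controllable), and fix a final time $T>0$. Then there exists a constant $\kappa>0$ such that for every smooth $f:\mathbb{R}^n\to\mathbb{R}^n$ whose Jacobian satisfies $\|Df(x)\|<\kappa$ for all $x\in\mathbb{R}^n$, the control system $$\frac{dx(t)}{dt}=Ax(t)+Bw(t)+f(x(t))$$ is locally controllable at time $T$ (for every initial state $x_0\in\mathbb{R}^n$).
   Context: Here $\|\cdot\|$ on matrices is the operator norm induced by the Euclidean norm. Controls $w$ are arbitrary smooth real-valued functions on $[0,T]$. The end-point map is $V_T[w,x_0]:=x(T)$, where $x$ solves the system with control $w$ and $x(0)=x_0$. The system is locally controllable (locally surjective) if for every control $w$ the derivative of the end-point map with respect to the control, $\delta w\mapsto dV_T|_w[\delta w]\in\mathbb{R}^n$ (with $\delta w$ ranging over smooth functions on $[0,T]$), is surjective onto $\mathbb{R}^n$. *)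

theory Defs
  imports "HOL-Analysis.Analysis"
begin

(* The infix ^ on real^'n^'n is not the matrix power: multiplication there is componentwise. *)
definition matrix_power :: "real^'n^'n \<Rightarrow> nat \<Rightarrow> real^'n^'n" where
  "matrix_power A k = ((\<lambda>M. A ** M) ^^ k) (mat 1)"

(* The matrix [B, AB, ..., A^(n-1) B]. Columns are indexed by the type 'n, so a numbering
   e of 'n by 0, ..., n-1 says which column is which power; a different numbering permutes
   the columns and so changes the determinant at most by its sign. *)
definition kalman_matrix :: "('n \<Rightarrow> nat) \<Rightarrow> real^'n^'n \<Rightarrow> real^'n \<Rightarrow> real^'n^'n" where
  "kalman_matrix e A B = (\<chi> i j. (matrix_power A (e j) *v B) $ i)"

(* C^k and C^infinity through iterated directional derivatives taken within S. It is meant for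
   sets S on which derivatives within S are unique, here the whole space and nondegenerate
   compact intervals, where the derivatives at the end points are one-sided. *)
primrec Ck_on :: "nat \<Rightarrow> 'a::euclidean_space set \<Rightarrow> ('a \<Rightarrow> 'b::euclidean_space) \<Rightarrow> bool" where
  "Ck_on 0 S f \<longleftrightarrow> continuous_on S f"
| "Ck_on (Suc k) S f \<longleftrightarrow> f differentiable_on S \<and>
     (\<forall>v. Ck_on k S (\<lambda>x. frechet_derivative f (at x within S) v))"

definition smooth_on :: "'a::euclidean_space set \<Rightarrow> ('a \<Rightarrow> 'b::euclidean_space) \<Rightarrow> bool" where
  "smooth_on S f \<longleftrightarrow> (\<forall>k. Ck_on k S f)"

definition is_trajectory ::
  "real^'n^'n \<Rightarrow> real^'n \<Rightarrow> (real^'n \<Rightarrow> real^'n) \<Rightarrow> real \<Rightarrow> (real \<Rightarrow> real) \<Rightarrow> real^'n \<Rightarrow>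
   (real \<Rightarrow> real^'n) \<Rightarrow> bool" where
  "is_trajectory A B f T w x0 x \<longleftrightarrow> x 0 = x0 \<and>
     (\<forall>t\<in>{0..T}. (x has_vector_derivative (A *v x t + w t *\<^sub>R B + f (x t)))
        (at t within {0..T}))"

definition is_end_point ::
  "real^'n^'n \<Rightarrow> real^'n \<Rightarrow> (real^'n \<Rightarrow> real^'n) \<Rightarrow> real \<Rightarrow> (real \<Rightarrow> real) \<Rightarrow> real^'n \<Rightarrow>
   real^'n \<Rightarrow> bool" where
  "is_end_point A B f T w x0 y \<longleftrightarrow> (\<exists>x. is_trajectory A B f T w x0 x \<and> x T = y)"

definition end_point ::
  "real^'n^'n \<Rightarrow> real^'n \<Rightarrow> (real^'n \<Rightarrow> real^'n) \<Rightarrow> real \<Rightarrow> (real \<Rightarrow> real) \<Rightarrow> real^'n \<Rightarrow> real^'n"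
  where
  "end_point A B f T w x0 = (THE y. is_end_point A B f T w x0 y)"

(* L is the (Gateaux) derivative of w |-> V_T[w, x0] at w: a linear map on the space of smooth
   functions on [0,T] giving the directional derivatives. Functions on [0,T] are represented by
   total functions, of which the system only sees the values on [0,T]. *)
definition has_end_point_derivative ::
  "real^'n^'n \<Rightarrow> real^'n \<Rightarrow> (real^'n \<Rightarrow> real^'n) \<Rightarrow> real \<Rightarrow> (real \<Rightarrow> real) \<Rightarrow> real^'n \<Rightarrow>
   ((real \<Rightarrow> real) \<Rightarrow> real^'n) \<Rightarrow> bool" where
  "has_end_point_derivative A B f T w x0 L \<longleftrightarrow>
     (\<forall>u. smooth_on {0..T} u \<longrightarrow>
        ((\<lambda>s. end_point A B f T (\<lambda>t. w t + s * u t) x0) has_vector_derivative L u) (at 0)) \<and>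
     (\<forall>u v a b. smooth_on {0..T} u \<longrightarrow> smooth_on {0..T} v \<longrightarrow>
        L (\<lambda>t. a * u t + b * v t) = a *\<^sub>R L u + b *\<^sub>R L v)"

(* The first conjunct makes the end-point map well defined, so that end_point is never
   an unspecified value. *)
definition locally_controllable ::
  "real^'n^'n \<Rightarrow> real^'n \<Rightarrow> (real^'n \<Rightarrow> real^'n) \<Rightarrow> real \<Rightarrow> real^'n \<Rightarrow> bool" where
  "locally_controllable A B f T x0 \<longleftrightarrow>
     (\<forall>w. smooth_on {0..T} w \<longrightarrow> (\<exists>!y. is_end_point A B f T w x0 y)) \<and>
     (\<forall>w. smooth_on {0..T} w \<longrightarrow>
        (\<exists>L. has_end_point_derivative A B f T w x0 L \<and>
             L ` {u. smooth_on {0..T} u} = UNIV))"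

end

theory Submission
  imports Defs
begin

text \<open>
The derivative of the end-point map at a control \<open>w\<close> sends \<open>u\<close> to \<open>\<xi> T\<close>, where
\<open>\<xi>' = (A + Df(x t)) \<xi> + u t B\<close>, \<open>\<xi> 0 = 0\<close>, and \<open>x\<close> is the trajectory for \<open>w\<close>
(\<open>end_point_derivative\<close>). All that this linear system knows of \<open>f\<close>, \<open>w\<close> and the initial state is
the matrix function \<open>Df(x t)\<close>, whose norm is below \<open>\<kappa>\<close>. So the theorem says that controllability
of the pair \<open>(A, B)\<close> survives small time-dependent perturbations of \<open>A\<close>, uniformly in the
perturbation.

For the unperturbed system the rank condition gives, for each standard basis vector, a smooth
control that steers the origin to it in time \<open>T\<close> (\<open>kalman_smooth_control\<close>); the proof is a duality
argument with the adjoint equation. The same finitely many controls, used in the perturbed system,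
end within \<open>O(\<kappa>)\<close> of the standard basis (\<open>response_perturbation\<close>), and vectors close enough to a basis
still span. Since the constant in \<open>O(\<kappa>)\<close> depends only on \<open>A\<close>, \<open>B\<close> and \<open>T\<close>, one \<open>\<kappa>\<close> works for all \<open>f\<close>,
\<open>w\<close> and initial states (\<open>response_surjective\<close>).

Every estimate is an instance of one Gronwall inequality (\<open>growth_bound\<close>): uniqueness of
solutions, closeness of perturbed responses, and the differentiability of the end-point map.
Existence of solutions is Picard's theorem in a weighted supremum norm
(\<open>lipschitz_ode_exists\<close>).
\<close>

section \<open>Smooth functions on a compact interval\<close>

lemma Ck_on_cong:
  assumes "Ck_on k S f" "\<And>x. x \<in> S \<Longrightarrow> f x = g x"
  shows "Ck_on k S g"
  using assms
proof (induction k arbitrary: f g)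
  case 0
  then show ?case
    using continuous_on_cong by force
next
  case (Suc k)
  have same: "(f has_derivative D) (at x within S) \<longleftrightarrow> (g has_derivative D) (at x within S)"
    if "x \<in> S" for x D
    using has_derivative_transform[OF that, of g f] has_derivative_transform[OF that, of f g]
      Suc.prems(2) by metis
  then have "frechet_derivative f (at x within S) = frechet_derivative g (at x within S)"
    if "x \<in> S" for x
    using that unfolding frechet_derivative_def by presburger
  moreover have "g differentiable_on S"
    using Suc.prems(1) same unfolding differentiable_on_def differentiable_def Ck_on.simps by meson
  moreover have "Ck_on k S (\<lambda>x. frechet_derivative g (at x within S) v)" for v
    by (rule Suc.IH[of "\<lambda>x. frechet_derivative f (at x within S) v"])
      (use Suc.prems(1) calculation(1) in simp_all)
  ultimately show ?case by simp
qed

text \<open>Derivatives within a nondegenerate interval are unique, also at its end points. This is what makes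
the iterated derivatives in the definition of \<open>Ck_on\<close> computable by the usual rules.\<close>
lemma frechet_derivative_interval:
  fixes f :: "real \<Rightarrow> 'b::euclidean_space"
  assumes "a < b" "t \<in> {a..b}" "(f has_derivative D) (at t within {a..b})"
  shows "frechet_derivative f (at t within {a..b}) = D"
  using frechet_derivative_within_cbox[of a b t f D] assms by (simp add: cbox_interval)

lemma Ck_on_lincomb:
  fixes f g :: "real \<Rightarrow> 'b::euclidean_space"
  assumes "a < b" "Ck_on k {a..b} f" "Ck_on k {a..b} g"
  shows "Ck_on k {a..b} (\<lambda>t. p *\<^sub>R f t + q *\<^sub>R g t)"
  using assms(2,3)
proof (induction k arbitrary: f g)
  case 0
  then show ?case by (auto intro!: continuous_intros)
next
  case (Suc k)
  let ?h = "\<lambda>t. p *\<^sub>R f t + q *\<^sub>R g t"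
  let ?D = "\<lambda>f t. frechet_derivative f (at t within {a..b})"
  have der: "(?h has_derivative (\<lambda>v. p *\<^sub>R ?D f t v + q *\<^sub>R ?D g t v)) (at t within {a..b})"
    if "t \<in> {a..b}" for t
    using Suc.prems that
    by (intro has_derivative_add has_derivative_scaleR_right)
      (simp_all add: differentiable_on_def flip: frechet_derivative_works)
  have eq: "p *\<^sub>R ?D f t v + q *\<^sub>R ?D g t v = ?D ?h t v" if "t \<in> {a..b}" for t v
    using frechet_derivative_interval[OF assms(1) that der[OF that]] by simp
  have "Ck_on k {a..b} (\<lambda>t. p *\<^sub>R ?D f t v + q *\<^sub>R ?D g t v)" for v
    using Suc by simp
  then have "Ck_on k {a..b} (\<lambda>t. ?D ?h t v)" for v
    by (rule Ck_on_cong) (rule eq)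
  moreover have "?h differentiable_on {a..b}"
    using der unfolding differentiable_on_def differentiable_def by blast
  ultimately show ?case by simp
qed

lemma smooth_on_lincomb:
  fixes f g :: "real \<Rightarrow> 'b::euclidean_space"
  assumes "a < b" "smooth_on {a..b} f" "smooth_on {a..b} g"
  shows "smooth_on {a..b} (\<lambda>t. p *\<^sub>R f t + q *\<^sub>R g t)"
  using assms by (simp add: smooth_on_def Ck_on_lincomb)

lemma Ck_on_zero: "Ck_on k {a..b} (\<lambda>_::real. 0::'b::euclidean_space)" if "a < b"
proof (induction k)
  case (Suc k)
  have "frechet_derivative (\<lambda>_. 0::'b) (at t within {a..b}) v = 0" if "t \<in> {a..b}" for t v
    using frechet_derivative_interval[OF \<open>a < b\<close> that, of "\<lambda>_. 0::'b" "\<lambda>_. 0"] by simp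
  then show ?case
    using Suc by (auto intro: Ck_on_cong)
qed simp

lemma smooth_on_zero:
  "smooth_on {a..b} (\<lambda>_::real. 0::'b::euclidean_space)" if "a < b"
  by (simp add: smooth_on_def Ck_on_zero that)

lemma smooth_on_sum:
  fixes f :: "'i \<Rightarrow> real \<Rightarrow> 'b::euclidean_space"
  assumes "a < b" "finite I" "\<And>i. i \<in> I \<Longrightarrow> smooth_on {a..b} (f i)"
  shows "smooth_on {a..b} (\<lambda>t. \<Sum>i\<in>I. c i *\<^sub>R f i t)"
  using assms(2,3)
proof (induction I rule: finite_induct)
  case empty
  then show ?case using smooth_on_zero[OF assms(1)] by simp
next
  case (insert i I)
  then show ?case
    using smooth_on_lincomb[OF assms(1), of "f i" "\<lambda>t. \<Sum>i\<in>I. c i *\<^sub>R f i t" "c i" 1] by simp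
qed

lemma smooth_on_imp_continuous_on: "smooth_on S f \<Longrightarrow> continuous_on S f"
  unfolding smooth_on_def by (metis Ck_on.simps(1))

text \<open>For functions of one real variable one vector-valued derivative carries all directional
derivatives, so an ODE bootstraps regularity: if the derivative is an expression in functions
already known to be \<open>C\<^sup>k\<close>, the solution is \<open>C\<^sup>k\<^sup>+\<^sup>1\<close>.\<close>
lemma Ck_on_SucI:
  fixes f :: "real \<Rightarrow> 'b::euclidean_space"
  assumes "a < b"
    and der: "\<And>t. t \<in> {a..b} \<Longrightarrow> (f has_vector_derivative g t) (at t within {a..b})"
    and "Ck_on k {a..b} g"
  shows "Ck_on (Suc k) {a..b} f"
proof -
  have eq: "v *\<^sub>R g t + 0 *\<^sub>R g t = frechet_derivative f (at t within {a..b}) v"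
    if "t \<in> {a..b}" for t v
    using frechet_derivative_interval[OF \<open>a < b\<close> that, of f] der[OF that]
    by (simp add: has_vector_derivative_def)
  have "Ck_on k {a..b} (\<lambda>t. frechet_derivative f (at t within {a..b}) v)" for v
    by (rule Ck_on_cong[OF Ck_on_lincomb[OF assms(1,3,3)]]) (rule eq)
  moreover have "f differentiable_on {a..b}"
    using der unfolding differentiable_on_def has_vector_derivative_def differentiable_def by blast
  ultimately show ?thesis by simp
qed

section \<open>Differential inequalities and Lipschitz equations\<close>

text \<open>Bounds how much an equation with Lipschitz constant \<open>K\<close> can amplify an inhomogeneity up to time
\<open>T\<close>. The value comes from the energy estimate below; that it depends on \<open>K\<close> and
\<open>T\<close> only makes all later bounds uniform in the control and in the nonlinearity.\<close>
definition growth :: "real \<Rightarrow> real \<Rightarrow> real" where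
  "growth K T = sqrt (T * exp ((2 * K + 1) * T))"

lemma growth_nonneg: "0 \<le> T \<Longrightarrow> 0 \<le> growth K T"
  by (simp add: growth_def)

text \<open>A Gronwall estimate for \<open>z' = d\<close>, \<open>z 0 = 0\<close>. The squared norm is differentiable where the norm is not,
and \<open>2 * c * norm z \<le> (norm z)\<^sup>2 + c\<^sup>2\<close> turns the bound on \<open>d\<close> into the linear inequality
\<open>(z \<bullet> z)' \<le> (2 * K + 1) * (z \<bullet> z) + c\<^sup>2\<close>, which an integrating factor solves.\<close>
lemma growth_bound:
  fixes z :: "real \<Rightarrow> 'b::euclidean_space"
  assumes z0: "z 0 = 0" and K: "0 \<le> K" and c: "0 \<le> c"
    and der: "\<And>t. t \<in> {0..T} \<Longrightarrow> (z has_vector_derivative d t) (at t within {0..T})"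
    and bnd: "\<And>t. t \<in> {0..T} \<Longrightarrow> norm (d t) \<le> K * norm (z t) + c"
    and t: "t \<in> {0..T}"
  shows "norm (z t) \<le> c * growth K T"
proof -
  define \<phi> where "\<phi> t = exp (- (2 * K + 1) * t) * (z t \<bullet> z t) - c\<^sup>2 * t" for t
  have cont: "continuous_on {0..T} z"
    using der has_vector_derivative_continuous continuous_on_eq_continuous_within by blast
  have "\<phi> 0 \<ge> \<phi> t"
  proof (rule DERIV_nonpos_imp_decreasing_open[of 0 t \<phi>])
    show "continuous_on {0..t} \<phi>"
      unfolding \<phi>_def using t by (auto intro!: continuous_intros continuous_on_subset[OF cont])
    fix s assume s: "0 < s" "s < t"
    have z: "(z has_derivative (\<lambda>v. v *\<^sub>R d s)) (at s)"
      using der[of s] s t by (simp add: at_within_Icc_at has_vector_derivative_def)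
    have 1: "(\<phi> has_real_derivative
        exp (- (2 * K + 1) * s) * (2 * (z s \<bullet> d s) - (2 * K + 1) * (z s \<bullet> z s)) - c\<^sup>2) (at s)"
      unfolding \<phi>_def has_field_derivative_def
      by (rule derivative_eq_intros refl z)+ (simp add: algebra_simps inner_commute fun_eq_iff)
    have "z s \<bullet> d s \<le> norm (z s) * norm (d s)"
      by (rule norm_cauchy_schwarz)
    also have "\<dots> \<le> norm (z s) * (K * norm (z s) + c)"
      using bnd[of s] s t by (intro mult_left_mono) auto
    also have "2 * \<dots> \<le> (2 * K + 1) * (z s \<bullet> z s) + c\<^sup>2"
      using sum_squares_bound[of "norm (z s)" c]
      by (simp add: algebra_simps power2_norm_eq_inner[symmetric] power2_eq_square)
    finally have "2 * (z s \<bullet> d s) - (2 * K + 1) * (z s \<bullet> z s) \<le> c\<^sup>2" by simp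
    then have "exp (- (2 * K + 1) * s) * (2 * (z s \<bullet> d s) - (2 * K + 1) * (z s \<bullet> z s)) \<le> 
      exp (- (2 * K + 1) * s) * c\<^sup>2"
      by (intro mult_left_mono) auto
    also have "\<dots> \<le> 1 * c\<^sup>2"
    proof (rule mult_right_mono)
      show "exp (- (2 * K + 1) * s) \<le> 1"
        unfolding exp_le_one_iff by (rule mult_nonpos_nonneg) (use K s in auto)
    qed simp
    finally have 2: "exp (- (2 * K + 1) * s) * (2 * (z s \<bullet> d s) - (2 * K + 1) * (z s \<bullet> z s)) - c\<^sup>2 \<le> 0"
      by simp
    from 1 2 show "\<exists>y. (\<phi> has_real_derivative y) (at s) \<and> y \<le> 0" by blast
  qed (use t in auto)
  then have "exp (- (2 * K + 1) * t) * (norm (z t))\<^sup>2 \<le> c\<^sup>2 * t"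
    by (simp add: \<phi>_def z0 power2_norm_eq_inner)
  then have "exp ((2 * K + 1) * t) * (exp (- (2 * K + 1) * t) * (norm (z t))\<^sup>2)
      \<le> exp ((2 * K + 1) * t) * (c\<^sup>2 * t)"
    by (intro mult_left_mono) auto
  moreover have "exp ((2 * K + 1) * t) * exp (- (2 * K + 1) * t) = 1"
    by (simp add: algebra_simps flip: exp_add)
  ultimately have "(norm (z t))\<^sup>2 \<le> exp ((2 * K + 1) * t) * (c\<^sup>2 * t)"
    by (simp only: mult.assoc[symmetric] mult_1_left)
  also have "\<dots> \<le> exp ((2 * K + 1) * T) * (c\<^sup>2 * T)"
    using t K by (intro mult_mono) auto
  also have "\<dots> = (c * growth K T)\<^sup>2"
    using t by (simp add: growth_def power_mult_distrib)
  finally show ?thesis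
    by (rule power2_le_imp_le) (use c t growth_nonneg in auto)
qed

lemma lipschitz_ode_unique:
  fixes F :: "real \<Rightarrow> 'a::euclidean_space \<Rightarrow> 'a"
  assumes K: "0 \<le> K"
    and lip: "\<And>t x y. t \<in> {0..T} \<Longrightarrow> norm (F t x - F t y) \<le> K * norm (x - y)"
    and x: "\<And>t. t \<in> {0..T} \<Longrightarrow> (x has_vector_derivative F t (x t)) (at t within {0..T})"
    and y: "\<And>t. t \<in> {0..T} \<Longrightarrow> (y has_vector_derivative F t (y t)) (at t within {0..T})"
    and "x 0 = y 0" "t \<in> {0..T}"
  shows "x t = y t"
  using growth_bound[of "\<lambda>t. x t - y t" K 0 T "\<lambda>t. F t (x t) - F t (y t)" t] assms
  by (simp add: has_vector_derivative_diff)

text \<open>Solutions exist on all of \<open>{0..T}\<close> by a single application of the contraction principle, without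
gluing: with \<open>x t = exp (l * t) *\<^sub>R y t\<close> the Picard operator becomes a contraction for \<open>y\<close> in the
supremum norm as soon as \<open>l > K\<close>.\<close>
lemma lipschitz_ode_exists:
  fixes F :: "real \<Rightarrow> 'a::euclidean_space \<Rightarrow> 'a"
  assumes T: "0 \<le> T" and K: "0 \<le> K"
    and lip: "\<And>t x y. t \<in> {0..T} \<Longrightarrow> norm (F t x - F t y) \<le> K * norm (x - y)"
    and cont: "\<And>x. continuous_on {0..T} x \<Longrightarrow> continuous_on {0..T} (\<lambda>t. F t (x t))"
  obtains x where "x 0 = x0"
    "\<forall>t\<in>{0..T}. (x has_vector_derivative F t (x t)) (at t within {0..T})"
proof -
  define l where "l = 2 * K + 1"
  have l: "l > 0" using K by (simp add: l_def)
  define h where "h y s = F s (exp (l * s) *\<^sub>R apply_bcontfun y s)" for y s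
  define G where "G y t = exp (- l * t) *\<^sub>R (x0 + integral {0..t} (h y))" for y t
  \<comment> \<open>Bounded continuous functions live on the whole line, so the interval is reached by a
    retraction; only the values on \<open>{0..T}\<close> enter the operator.\<close>
  define clip where "clip t = max 0 (min T t)" for t :: real
  have clip: "clip t \<in> {0..T}" "t \<in> {0..T} \<Longrightarrow> clip t = t" for t
    using T by (auto simp: clip_def)
  have contclip: "continuous_on UNIV clip"
    unfolding clip_def by (intro continuous_intros)
  define P where "P y = Bcontfun (\<lambda>t. G y (clip t))" for y
  have conth: "continuous_on {0..T} (h y)" for y
    unfolding h_def by (intro cont continuous_intros continuous_on_apply_bcontfun)
  then have inth: "h y integrable_on {0..t}" if "t \<in> {0..T}" for y t
    using that by (intro integrable_continuous_real continuous_on_subset[OF conth]) auto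
  have derh: "((\<lambda>t. integral {0..t} (h y)) has_vector_derivative h y t) (at t within {0..T})"
    if "t \<in> {0..T}" for y t
    using integral_has_vector_derivative[OF conth that] .
  have contG: "continuous_on {0..T} (G y)" for y
    unfolding G_def
    by (intro continuous_intros indefinite_integral_continuous_1 inth) (use T in auto)
  have "(\<lambda>t. G y (clip t)) \<in> bcontfun" for y
  proof -
    have "range (\<lambda>t. G y (clip t)) \<subseteq> G y ` {0..T}"
      using clip(1) by auto
    moreover have "bounded (G y ` {0..T})"
      by (intro compact_imp_bounded compact_continuous_image contG) auto
    moreover have "continuous_on UNIV (\<lambda>t. G y (clip t))"
      by (intro continuous_on_compose2[OF contG contclip]) (use clip(1) in auto)
    ultimately show ?thesis
      using bounded_subset by (auto simp: bcontfun_def)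
  qed
  then have P: "apply_bcontfun (P y) t = G y (clip t)" for y t
    by (simp add: P_def Bcontfun_inverse)
  have "dist (P y) (P z) \<le> 1 / 2 * dist y z" for y z
  proof (rule dist_bound)
    fix t
    define \<tau> where "\<tau> = clip t"
    have \<tau>: "\<tau> \<in> {0..T}" using clip by (simp add: \<tau>_def)
    let ?g = "\<lambda>s. K * dist y z * exp (l * s)"
    have g: "(?g has_integral (K * dist y z / l * exp (l * \<tau>) - K * dist y z / l * exp (l * 0))) {0..\<tau>}"
      by (rule fundamental_theorem_of_calculus)
        (use l \<tau> in \<open>auto intro!: derivative_eq_intros
            simp: has_real_derivative_iff_has_vector_derivative[symmetric]\<close>)
    have "norm (integral {0..\<tau>} (\<lambda>s. h y s - h z s)) \<le> integral {0..\<tau>} ?g"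
    proof (rule integral_norm_bound_integral)
      fix s assume s: "s \<in> {0..\<tau>}"
      have "norm (h y s - h z s) \<le> K * norm (exp (l * s) *\<^sub>R (y s - z s))"
        unfolding h_def scaleR_diff_right using lip s \<tau> by auto
      also have "\<dots> = K * (exp (l * s) * dist (y s) (z s))"
        by (simp add: dist_norm)
      also have "\<dots> \<le> K * (exp (l * s) * dist y z)"
        using K by (intro mult_left_mono dist_bounded) auto
      finally show "norm (h y s - h z s) \<le> ?g s" by (simp add: mult_ac)
    qed (use g inth \<tau> in \<open>auto intro!: integrable_diff\<close>)
    also have "\<dots> = K * dist y z / l * (exp (l * \<tau>) - 1)"
      using integral_unique[OF g] by (simp only: mult_zero_right exp_zero right_diff_distrib)
    also have "\<dots> \<le> K * dist y z / l * exp (l * \<tau>)"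
      using K l by (intro mult_left_mono) auto
    also have "\<dots> \<le> (1 / 2 * dist y z) * exp (l * \<tau>)"
      using K l mult_right_mono[of "K / l" "1/2" "dist y z"]
      by (intro mult_right_mono) (auto simp: l_def field_simps)
    finally have I: "norm (integral {0..\<tau>} (\<lambda>s. h y s - h z s)) \<le> 1 / 2 * dist y z * exp (l * \<tau>)" .
    have "G y \<tau> - G z \<tau> = exp (- l * \<tau>) *\<^sub>R integral {0..\<tau>} (\<lambda>s. h y s - h z s)"
      unfolding G_def using inth[OF \<tau>]
      by (simp add: Henstock_Kurzweil_Integration.integral_diff scaleR_diff_right[symmetric])
    then have "dist (G y \<tau>) (G z \<tau>) = exp (- l * \<tau>) * norm (integral {0..\<tau>} (\<lambda>s. h y s - h z s))"
      by (simp add: dist_norm)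
    also have "\<dots> \<le> exp (- l * \<tau>) * (1 / 2 * dist y z * exp (l * \<tau>))"
      by (intro mult_left_mono I) auto
    also have "\<dots> = 1 / 2 * dist y z"
      by (simp add: exp_minus)
    finally show "dist (P y t) (P z t) \<le> 1 / 2 * dist y z"
      by (simp add: P \<tau>_def)
  qed
  then obtain y where y: "P y = y"
    using banach_fix_type[of "1/2" P] by auto
  define x where "x t = x0 + integral {0..t} (h y)" for t
  have "exp (l * t) *\<^sub>R y t = x t" if "t \<in> {0..T}" for t
  proof -
    have "y t = G y t" using P[of y t] clip(2)[OF that] y by simp
    then show ?thesis by (simp add: G_def x_def exp_minus)
  qed
  then have der: "(x has_vector_derivative F t (x t)) (at t within {0..T})" if "t \<in> {0..T}" for t
    using derh[OF that, of y] that unfolding x_def h_def by (auto intro!: derivative_eq_intros)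
  have "x 0 = x0" by (simp add: x_def)
  then show thesis by (rule that) (simp add: der)
qed

section \<open>Responses of linear control systems\<close>

lemma norm_matrix_vector_le: "norm (M *v x) \<le> onorm ((*v) M) * norm x"
  for M :: "real^'m^'n"
  by (rule onorm[OF matrix_vector_mul_bounded_linear])

lemma onorm_matrix_add_le: "onorm ((*v) (M + N)) \<le> onorm ((*v) M) + onorm ((*v) N)"
  for M N :: "real^'m^'n"
proof -
  have "(\<lambda>x. M *v x + N *v x) = (*v) (M + N)"
    by (simp add: fun_eq_iff matrix_vector_mult_add_rdistrib)
  then show ?thesis
    using onorm_triangle[OF matrix_vector_mul_bounded_linear[of M]
        matrix_vector_mul_bounded_linear[of N]] by simp
qed

lemma continuous_on_matrix_vector_mult [continuous_intros]:
  fixes N :: "'a::topological_space \<Rightarrow> real^'m^'n"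
  assumes "continuous_on S N" "continuous_on S x"
  shows "continuous_on S (\<lambda>t. N t *v x t)"
  unfolding matrix_vector_mult_def using assms
  by (intro continuous_intros)

text \<open>The solution of \<open>\<xi>' = N t \<xi> + u t B\<close> from rest. For \<open>N t = A\<close> it is the trajectory of the linear system;
for \<open>N t\<close> the sum of \<open>A\<close> and the Jacobian along a trajectory, its value at \<open>T\<close> is the derivative of the
end-point map in direction \<open>u\<close>.\<close>
definition is_response ::
  "(real \<Rightarrow> real^'n^'n) \<Rightarrow> real^'n \<Rightarrow> real \<Rightarrow> (real \<Rightarrow> real) \<Rightarrow> (real \<Rightarrow> real^'n) \<Rightarrow> bool" where
  "is_response N B T u \<xi> \<longleftrightarrow> \<xi> 0 = 0 \<and>
     (\<forall>t\<in>{0..T}. (\<xi> has_vector_derivative (N t *v \<xi> t + u t *\<^sub>R B)) (at t within {0..T}))"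

lemma is_response_exists:
  assumes "0 \<le> T" "continuous_on {0..T} N" "continuous_on {0..T} u"
    and K: "\<And>t. t \<in> {0..T} \<Longrightarrow> onorm ((*v) (N t)) \<le> K"
  obtains \<xi> where "is_response N B T u \<xi>"
proof -
  have "0 \<le> K"
    using K[of 0] onorm_pos_le[OF matrix_vector_mul_bounded_linear, of "N 0"] \<open>0 \<le> T\<close> by auto
  moreover have "norm ((N t *v x + u t *\<^sub>R B) - (N t *v y + u t *\<^sub>R B)) \<le> K * norm (x - y)"
    if "t \<in> {0..T}" for t x y
    using norm_matrix_vector_le[of "N t" "x - y"] mult_right_mono[OF K[OF that], of "norm (x - y)"]
    by (simp add: matrix_vector_mult_diff_distrib)
  moreover have "continuous_on {0..T} (\<lambda>t. N t *v x t + u t *\<^sub>R B)"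
    if "continuous_on {0..T} x" for x
    by (intro continuous_intros assms that)
  ultimately obtain \<xi> where "\<xi> 0 = 0" "\<forall>t\<in>{0..T}.
      (\<xi> has_vector_derivative N t *v \<xi> t + u t *\<^sub>R B) (at t within {0..T})"
    by (rule lipschitz_ode_exists[OF \<open>0 \<le> T\<close>, of K "\<lambda>t x. N t *v x + u t *\<^sub>R B" 0])
  then show thesis
    by (intro that[of \<xi>]) (simp add: is_response_def)
qed

lemma is_response_unique:
  assumes K: "\<And>t. t \<in> {0..T} \<Longrightarrow> onorm ((*v) (N t)) \<le> K"
    and "is_response N B T u \<xi>" "is_response N B T u \<eta>" "t \<in> {0..T}"
  shows "\<xi> t = \<eta> t"
proof (rule lipschitz_ode_unique[of K T "\<lambda>t x. N t *v x + u t *\<^sub>R B"])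
  show "0 \<le> K"
    using K[OF \<open>t \<in> _\<close>] onorm_pos_le[OF matrix_vector_mul_bounded_linear, of "N t"] by simp
  show "norm ((N t *v x + u t *\<^sub>R B) - (N t *v y + u t *\<^sub>R B)) \<le> K * norm (x - y)"
    if "t \<in> {0..T}" for t x y
    using norm_matrix_vector_le[of "N t" "x - y"] mult_right_mono[OF K[OF that], of "norm (x - y)"]
    by (simp add: matrix_vector_mult_diff_distrib)
qed (use assms in \<open>auto simp: is_response_def\<close>)

lemma is_response_lincomb:
  assumes "is_response N B T u \<xi>" "is_response N B T v \<eta>"
  shows "is_response N B T (\<lambda>t. a * u t + b * v t) (\<lambda>t. a *\<^sub>R \<xi> t + b *\<^sub>R \<eta> t)"
  using assms unfolding is_response_def
  by (auto intro!: derivative_eq_intros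
      simp: matrix_vector_right_distrib algebra_simps matrix_vector_mult_scaleR)

lemma is_response_sum:
  assumes "finite I" "\<And>i. i \<in> I \<Longrightarrow> is_response N B T (u i) (\<xi> i)"
  shows "is_response N B T (\<lambda>t. \<Sum>i\<in>I. c i * u i t) (\<lambda>t. \<Sum>i\<in>I. c i *\<^sub>R \<xi> i t)"
  using assms
proof (induction I rule: finite_induct)
  case empty
  then show ?case by (simp add: is_response_def)
next
  case (insert i I)
  then show ?case
    using is_response_lincomb[of N B T "u i" "\<xi> i" "\<lambda>t. \<Sum>i\<in>I. c i * u i t"
        "\<lambda>t. \<Sum>i\<in>I. c i *\<^sub>R \<xi> i t" "c i" 1] by simp
qed

section \<open>Smooth controls for the linear system\<close>

text \<open>A terminal value problem, solved forwards after the time reversal \<open>t \<mapsto> T - t\<close>.\<close>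
lemma adjoint_exists:
  fixes A :: "real^'n^'n"
  assumes "0 \<le> T"
  obtains p where "p T = \<eta>"
    "\<And>t. t \<in> {0..T} \<Longrightarrow> (p has_vector_derivative - (p t v* A)) (at t within {0..T})"
proof -
  let ?M = "transpose A"
  have "norm (?M *v x - ?M *v y) \<le> onorm ((*v) ?M) * norm (x - y)" for x y
    using norm_matrix_vector_le[of ?M "x - y"] by (simp add: matrix_vector_mult_diff_distrib)
  then obtain q where q: "q 0 = \<eta>"
    "\<forall>t\<in>{0..T}. (q has_vector_derivative ?M *v q t) (at t within {0..T})"
    by (rule lipschitz_ode_exists[OF assms onorm_pos_le[OF matrix_vector_mul_bounded_linear],
          where F = "\<lambda>_ x. ?M *v x" and ?x0.0 = \<eta>])
      (intro continuous_intros)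
  have img: "(\<lambda>t. T - t) ` {0..T} = {0..T}" by simp
  have "((\<lambda>t. q (T - t)) has_vector_derivative - (q (T - t) v* A)) (at t within {0..T})"
    if t: "t \<in> {0..T}" for t
  proof -
    have 1: "((\<lambda>t. T - t) has_vector_derivative - 1) (at t within {0..T})"
      by (auto intro!: derivative_eq_intros)
    have "(q has_vector_derivative ?M *v q (T - t)) (at (T - t) within (\<lambda>t. T - t) ` {0..T})"
      using q(2) t unfolding img by simp
    from vector_diff_chain_within[OF 1 this] show ?thesis
      by (simp add: o_def transpose_matrix_vector)
  qed
  then show thesis using q(1) by (intro that[of "\<lambda>t. q (T - t)"]) auto
qed

text \<open>The derivative of \<open>p \<bullet> c\<close> is \<open>p \<bullet> (- A c)\<close>, again a function of the same form. The claim for all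
\<open>c\<close> at once is therefore an induction on the order of differentiability.\<close>
lemma smooth_on_adjoint:
  fixes A :: "real^'n^'n"
  assumes "0 < T"
    and p: "\<And>t. t \<in> {0..T} \<Longrightarrow> (p has_vector_derivative - (p t v* A)) (at t within {0..T})"
  shows "smooth_on {0..T} (\<lambda>t. p t \<bullet> c)"
proof -
  have der: "((\<lambda>t. p t \<bullet> c) has_vector_derivative p t \<bullet> (- (A *v c))) (at t within {0..T})"
    if "t \<in> {0..T}" for t c
    using bounded_linear.has_vector_derivative[OF bounded_linear_inner_left p[OF that], of c]
    by (simp add: dot_lmul_matrix)
  have "Ck_on k {0..T} (\<lambda>t. p t \<bullet> c)" for k
  proof (induction k arbitrary: c)
    case 0
    then show ?case
      using der has_vector_derivative_continuous continuous_on_eq_continuous_within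
      by (metis Ck_on.simps(1))
  next
    case (Suc k)
    show ?case by (rule Ck_on_SucI[OF \<open>0 < T\<close> der Suc])
  qed
  then show ?thesis by (simp add: smooth_on_def)
qed

text \<open>Differentiating \<open>p \<bullet> B = 0\<close> repeatedly gives \<open>p \<bullet> A\<^sup>k B = 0\<close> for all \<open>k\<close>. So \<open>p T\<close> is orthogonal to every
column of the Kalman matrix, and these columns span the space.\<close>
lemma adjoint_observability:
  fixes A :: "real^'n^'n"
  assumes "0 < T"
    and p: "\<And>t. t \<in> {0..T} \<Longrightarrow> (p has_vector_derivative - (p t v* A)) (at t within {0..T})"
    and pB: "\<And>t. t \<in> {0..T} \<Longrightarrow> p t \<bullet> B = 0"
    and det: "det (kalman_matrix e A B) \<noteq> 0"
  shows "p T = 0"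
proof -
  have *: "\<forall>t\<in>{0..T}. p t \<bullet> (matrix_power A k *v B) = 0" for k
  proof (induction k)
    case 0
    then show ?case using pB by (simp add: matrix_power_def)
  next
    case (Suc k)
    let ?c = "matrix_power A k *v B"
    show ?case
    proof
      fix t assume t: "t \<in> {0..T}"
      have "((\<lambda>t. p t \<bullet> ?c) has_vector_derivative - (p t \<bullet> (A *v ?c))) (at t within {0..T})"
        using bounded_linear.has_vector_derivative[OF bounded_linear_inner_left p[OF t], of ?c]
        by (simp add: dot_lmul_matrix)
      moreover have "((\<lambda>t. p t \<bullet> ?c) has_vector_derivative 0) (at t within {0..T})"
        using Suc by (intro has_vector_derivative_transform[OF t _ has_vector_derivative_const]) auto
      ultimately have "- (p t \<bullet> (A *v ?c)) = 0"
        using \<open>0 < T\<close> t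
        by (intro vector_derivative_unique_within_closed_interval[of 0 T t "\<lambda>t. p t \<bullet> ?c"])
          (simp_all add: cbox_interval)
      then show "p t \<bullet> (matrix_power A (Suc k) *v B) = 0"
        by (simp add: matrix_power_def matrix_vector_mul_assoc)
    qed
  qed
  let ?K = "kalman_matrix e A B"
  have "(transpose ?K *v p T) $ j = p T \<bullet> (matrix_power A (e j) *v B)" for j
    unfolding kalman_matrix_def transpose_def inner_vec_def
    by (subst matrix_vector_mult_def) (simp add: mult.commute)
  then have "transpose ?K *v p T = 0"
    using * \<open>0 < T\<close> by (simp add: vec_eq_iff)
  moreover obtain M where "M ** transpose ?K = mat 1"
    using det invertible_det_nz[of "transpose ?K"] by (auto simp: invertible_def)
  ultimately have "mat 1 *v p T = M *v 0"
    by (metis matrix_vector_mul_assoc)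
  then show ?thesis by simp
qed

text \<open>The points reachable by smooth controls form a subspace. If \<open>\<eta>\<close> is orthogonal to it and \<open>p\<close> is the
adjoint solution ending at \<open>\<eta>\<close>, then \<open>(p \<bullet> \<xi>)' = (p \<bullet> B) u\<close> along every response. The control
\<open>u = p \<bullet> B\<close> is itself smooth, and for it \<open>\<eta> \<bullet> \<xi> T = 0\<close> is the integral of \<open>u\<^sup>2\<close>; hence \<open>u = 0\<close>,
and \<open>\<eta> = 0\<close> by observability.\<close>
lemma kalman_smooth_control:
  fixes A :: "real^'n^'n"
  assumes T: "0 < T" and det: "det (kalman_matrix e A B) \<noteq> 0"
  obtains u \<xi> where "smooth_on {0..T} u" "is_response (\<lambda>_. A) B T u \<xi>" "\<xi> T = y"
proof -
  define R where "R = {\<xi> T | u \<xi>. smooth_on {0..T} u \<and> is_response (\<lambda>_. A) B T u \<xi>}"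
  have comb: "a *\<^sub>R y + b *\<^sub>R z \<in> R" if yz: "y \<in> R" "z \<in> R" for a b y z
  proof -
    obtain u \<xi> v \<eta> where
      "smooth_on {0..T} u" "is_response (\<lambda>_. A) B T u \<xi>" "y = \<xi> T"
      "smooth_on {0..T} v" "is_response (\<lambda>_. A) B T v \<eta>" "z = \<eta> T"
      using yz unfolding R_def by blast
    then show ?thesis
      using smooth_on_lincomb[OF T, of u v a b] is_response_lincomb[of "\<lambda>_. A" B T u \<xi> v \<eta> a b]
      unfolding R_def by auto
  qed
  have "0 \<in> R"
    using smooth_on_zero[OF T, where 'b = real]
    unfolding R_def is_response_def by (intro CollectI exI[of _ "\<lambda>_. 0"]) auto
  then have "subspace R"
    using comb[of _ _ 1 1] comb[of _ 0 _ 0] by (intro subspaceI) auto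
  have "R = UNIV"
  proof (rule ccontr)
    assume "R \<noteq> UNIV"
    moreover have "span R = R" using \<open>subspace R\<close> by (simp only: span_eq_iff)
    ultimately have "dim R < DIM(real^'n)"
      using dim_eq_full[of R] dim_subset_UNIV[of R] le_neq_implies_less by metis
    then obtain \<eta> where "\<eta> \<noteq> 0" and \<eta>: "\<forall>y\<in>span R. orthogonal \<eta> y"
      by (rule orthogonal_to_subspace_exists) auto
    obtain p where pT: "p T = \<eta>" and p: "\<And>t. t \<in> {0..T} \<Longrightarrow>
        (p has_vector_derivative - (p t v* A)) (at t within {0..T})"
      using adjoint_exists[of T \<eta> A] T by (metis less_imp_le)
    define u where "u t = p t \<bullet> B" for t
    have u: "smooth_on {0..T} u"
      unfolding u_def by (rule smooth_on_adjoint[OF T p])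
    obtain \<xi> where \<xi>: "is_response (\<lambda>_. A) B T u \<xi>"
      by (rule is_response_exists[of T "\<lambda>_. A" u "onorm ((*v) A)" B])
        (use T smooth_on_imp_continuous_on[OF u] in \<open>auto intro!: continuous_intros\<close>)
    have "((\<lambda>t. p t \<bullet> \<xi> t) has_vector_derivative (u t)\<^sup>2) (at t within {0..T})"
      if t: "t \<in> {0..T}" for t
    proof -
      have "(\<xi> has_vector_derivative (A *v \<xi> t + u t *\<^sub>R B)) (at t within {0..T})"
        using \<xi> t by (simp add: is_response_def)
      from bounded_bilinear.has_vector_derivative[OF bounded_bilinear_inner p[OF t] this]
      show ?thesis
        by (simp add: inner_add_right dot_lmul_matrix u_def power2_eq_square)
    qed
    then have "((\<lambda>t. (u t)\<^sup>2) has_integral (p T \<bullet> \<xi> T - p 0 \<bullet> \<xi> 0)) {0..T}"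
      using T by (intro fundamental_theorem_of_calculus) auto
    moreover have "p T \<bullet> \<xi> T = 0"
    proof -
      have "\<xi> T \<in> R" using u \<xi> unfolding R_def by auto
      then show ?thesis using \<eta> pT by (simp add: span_base orthogonal_def)
    qed
    moreover have "\<xi> 0 = 0" using \<xi> by (simp add: is_response_def)
    ultimately have "integral {0..T} (\<lambda>t. (u t)\<^sup>2) = 0"
      by (simp add: integral_unique)
    then have "(u t)\<^sup>2 = 0" if "t \<in> {0..T}" for t
      using integral_eq_0_iff[of 0 T "\<lambda>t. (u t)\<^sup>2"] T that
        continuous_on_power[OF smooth_on_imp_continuous_on[OF u], of 2] by simp
    then have "p T = 0"
      using adjoint_observability[OF T p _ det] by (simp add: u_def)
    then show False using pT \<open>\<eta> \<noteq> 0\<close> by simp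
  qed
  then have "y \<in> R" by simp
  then obtain u \<xi> where "y = \<xi> T" "smooth_on {0..T} u" "is_response (\<lambda>_. A) B T u \<xi>"
    unfolding R_def by auto
  then show thesis by (intro that[of u \<xi>]) auto
qed

section \<open>Surjectivity under small perturbations\<close>

text \<open>The difference of the two responses solves an equation driven by \<open>(N t - A) \<xi>\<close>. Writing
\<open>\<xi> = (\<xi> - \<eta>) + \<eta>\<close> there puts one part, at most \<open>norm (\<xi> - \<eta>)\<close> because \<open>\<kappa> \<le> 1\<close>, into the growth
rate and leaves an inhomogeneity of size \<open>\<kappa> * R\<close> that refers only to the unperturbed response.\<close>
lemma response_perturbation:
  fixes A :: "real^'n^'n"
  assumes T: "0 \<le> T" and "\<kappa> \<le> 1" "0 \<le> R"
    and N: "\<And>t. t \<in> {0..T} \<Longrightarrow> onorm ((*v) (N t - A)) \<le> \<kappa>"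
    and \<xi>: "is_response N B T u \<xi>" and \<eta>: "is_response (\<lambda>_. A) B T u \<eta>"
    and R: "\<And>t. t \<in> {0..T} \<Longrightarrow> norm (\<eta> t) \<le> R"
  shows "norm (\<xi> T - \<eta> T) \<le> \<kappa> * R * growth (onorm ((*v) A) + 1) T"
proof (rule growth_bound[of "\<lambda>t. \<xi> t - \<eta> t" _ _ T "\<lambda>t. A *v (\<xi> t - \<eta> t) + (N t - A) *v \<xi> t"])
  have "0 \<le> \<kappa>"
    using N[of 0] T onorm_pos_le[OF matrix_vector_mul_bounded_linear, of "N 0 - A"] by simp
  show "0 \<le> \<kappa> * R" using \<open>0 \<le> \<kappa>\<close> \<open>0 \<le> R\<close> by simp
  show "0 \<le> onorm ((*v) A) + 1"
    using onorm_pos_le[OF matrix_vector_mul_bounded_linear, of A] by simp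
  show "((\<lambda>t. \<xi> t - \<eta> t) has_vector_derivative A *v (\<xi> t - \<eta> t) + (N t - A) *v \<xi> t)
      (at t within {0..T})" if "t \<in> {0..T}" for t
    using \<xi> \<eta> that unfolding is_response_def
    by (auto intro!: derivative_eq_intros
        simp: matrix_vector_mult_diff_distrib matrix_vector_mult_diff_rdistrib)
  show "norm (A *v (\<xi> t - \<eta> t) + (N t - A) *v \<xi> t)
      \<le> (onorm ((*v) A) + 1) * norm (\<xi> t - \<eta> t) + \<kappa> * R" if t: "t \<in> {0..T}" for t
  proof -
    have "norm ((N t - A) *v \<xi> t) \<le> \<kappa> * norm (\<xi> t)"
      using norm_matrix_vector_le[of "N t - A" "\<xi> t"] mult_right_mono[OF N[OF t], of "norm (\<xi> t)"]
      by simp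
    also have "\<dots> \<le> \<kappa> * (norm (\<xi> t - \<eta> t) + R)"
      using \<open>0 \<le> \<kappa>\<close> R[OF t] norm_triangle_sub[of "\<xi> t" "\<eta> t"] by (intro mult_left_mono) auto
    also have "\<dots> \<le> norm (\<xi> t - \<eta> t) + \<kappa> * R"
      using mult_right_mono[OF \<open>\<kappa> \<le> 1\<close>, of "norm (\<xi> t - \<eta> t)"] by (simp add: algebra_simps)
    finally show ?thesis
      using norm_triangle_ineq[of "A *v (\<xi> t - \<eta> t)" "(N t - A) *v \<xi> t"]
        norm_matrix_vector_le[of A "\<xi> t - \<eta> t"] by (simp add: algebra_simps)
  qed
qed (use T \<xi> \<eta> in \<open>auto simp: is_response_def\<close>)

text \<open>The linear map sending the standard basis to the \<open>v i\<close> differs from the identity by an operator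
of norm less than 1, hence is injective.\<close>
lemma span_near_standard_basis:
  fixes v :: "'n \<Rightarrow> real^'n"
  assumes v: "\<And>i. norm (v i - axis i 1) \<le> \<delta>" and \<delta>: "real CARD('n) * \<delta> < 1"
  obtains c :: "real^'n" where "(\<Sum>i\<in>UNIV. c $ i *\<^sub>R v i) = y"
proof -
  define \<Lambda> where "\<Lambda> x = (\<Sum>i\<in>UNIV. x $ i *\<^sub>R v i)" for x :: "real^'n"
  have lin: "linear \<Lambda>"
    unfolding \<Lambda>_def
    by (intro linearI) (simp_all add: scaleR_add_left sum.distrib scaleR_sum_right)
  have "x = 0" if "\<Lambda> x = 0" for x
  proof (rule ccontr)
    assume "x \<noteq> 0"
    have "x = (\<Sum>i\<in>UNIV. x $ i *\<^sub>R axis i 1)"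
      using basis_expansion[of x] by (simp add: scalar_mult_eq_scaleR)
    then have "x = (\<Sum>i\<in>UNIV. x $ i *\<^sub>R (axis i 1 - v i))"
      using that by (simp add: scaleR_diff_right sum_subtractf \<Lambda>_def)
    then have "norm x \<le> (\<Sum>i\<in>UNIV. norm (x $ i *\<^sub>R (axis i 1 - v i)))"
      by (metis norm_sum)
    also have "\<dots> \<le> (\<Sum>i\<in>(UNIV::'n set). norm x * \<delta>)"
      using v by (intro sum_mono)
        (auto intro!: mult_mono simp: norm_minus_commute component_le_norm_cart)
    also have "\<dots> = (real CARD('n) * \<delta>) * norm x" by simp
    also have "\<dots> < 1 * norm x" using \<delta> \<open>x \<noteq> 0\<close> by (intro mult_strict_right_mono) auto
    finally show False by simp
  qed
  then have "surj \<Lambda>"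
    using linear_injective_imp_surjective[OF lin] linear_injective_0[OF lin] by simp
  then obtain x where "y = \<Lambda> x" by (rule surjE)
  then show thesis by (intro that[of x]) (simp add: \<Lambda>_def)
qed

text \<open>The constant of the theorem. Finitely many smooth controls steer the linear system to the standard
basis vectors; they are chosen before the perturbation, so one \<open>\<kappa>\<close> keeps the perturbed
end points close to that basis for every \<open>N\<close>.\<close>
lemma response_surjective:
  fixes A :: "real^'n^'n"
  assumes T: "0 < T" and det: "det (kalman_matrix e A B) \<noteq> 0"
  obtains \<kappa> where "0 < \<kappa>"
    "\<And>N y. continuous_on {0..T} N \<Longrightarrow> (\<And>t. t \<in> {0..T} \<Longrightarrow> onorm ((*v) (N t - A)) \<le> \<kappa>) \<Longrightarrow>
       \<exists>u \<xi>. smooth_on {0..T} u \<and> is_response N B T u \<xi> \<and> \<xi> T = y"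
proof -
  have "\<exists>u \<eta>. smooth_on {0..T} u \<and> is_response (\<lambda>_. A) B T u \<eta> \<and> \<eta> T = axis i 1" for i
    by (rule kalman_smooth_control[OF T det]) blast
  then obtain u \<eta> where u: "\<And>i. smooth_on {0..T} (u i)"
    and \<eta>: "\<And>i. is_response (\<lambda>_. A) B T (u i) (\<eta> i)" and \<eta>T: "\<And>i. \<eta> i T = axis i 1"
    by metis
  have "\<exists>r>0. \<forall>t\<in>{0..T}. norm (\<eta> i t) \<le> r" for i
  proof -
    have "continuous_on {0..T} (\<eta> i)"
      using \<eta>[of i] has_vector_derivative_continuous
      unfolding is_response_def continuous_on_eq_continuous_within by blast
    then have "bounded (\<eta> i ` {0..T})"
      by (intro compact_imp_bounded compact_continuous_image) auto
    then show ?thesis by (auto simp: bounded_pos)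
  qed
  then obtain r where r: "\<And>i. r i > 0" "\<And>i t. t \<in> {0..T} \<Longrightarrow> norm (\<eta> i t) \<le> r i"
    by metis
  define R where "R = (\<Sum>i\<in>UNIV. r i)"
  have R0: "0 \<le> R" unfolding R_def using r(1) by (intro sum_nonneg) (auto intro: less_imp_le)
  have R: "norm (\<eta> i t) \<le> R" if "t \<in> {0..T}" for i t
  proof -
    have "r i \<le> R" unfolding R_def using r(1) by (intro member_le_sum) (auto intro: less_imp_le)
    then show ?thesis using r(2)[OF that, of i] by simp
  qed
  define G where "G = R * growth (onorm ((*v) A) + 1) T"
  have G: "0 \<le> G" using R0 T growth_nonneg by (simp add: G_def)
  define \<kappa> where "\<kappa> = 1 / (1 + real CARD('n) * G)"
  have nG: "0 \<le> real CARD('n) * G" using G by simp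
  have \<kappa>: "0 < \<kappa>" "\<kappa> \<le> 1" "real CARD('n) * (\<kappa> * G) < 1"
    using nG by (auto simp: \<kappa>_def field_simps add_pos_nonneg)
  show thesis
  proof (rule that[OF \<kappa>(1)])
    fix N :: "real \<Rightarrow> real^'n^'n" and y
    assume N: "continuous_on {0..T} N" "\<And>t. t \<in> {0..T} \<Longrightarrow> onorm ((*v) (N t - A)) \<le> \<kappa>"
    have K: "onorm ((*v) (N t)) \<le> onorm ((*v) A) + \<kappa>" if "t \<in> {0..T}" for t
      using onorm_matrix_add_le[of A "N t - A"] N(2)[OF that] by simp
    have "\<exists>\<xi>. is_response N B T (u i) \<xi>" for i
      by (rule is_response_exists[of T N "u i" "onorm ((*v) A) + \<kappa>" B])
        (use T N(1) smooth_on_imp_continuous_on[OF u] K in auto)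
    then obtain \<xi> where \<xi>: "\<And>i. is_response N B T (u i) (\<xi> i)" by metis
    have "norm (\<xi> i T - axis i 1) \<le> \<kappa> * G" for i
      using response_perturbation[OF _ \<kappa>(2) R0 N(2) \<xi>[of i] \<eta>[of i] R] T \<eta>T[of i]
      by (simp add: G_def)
    then obtain c :: "real^'n" where c: "(\<Sum>i\<in>UNIV. c $ i *\<^sub>R \<xi> i T) = y"
      using \<kappa>(3) by (rule span_near_standard_basis)
    have "smooth_on {0..T} (\<lambda>t. \<Sum>i\<in>UNIV. c $ i * u i t)"
      using smooth_on_sum[OF T, of UNIV u "\<lambda>i. c $ i"] u by simp
    moreover have "is_response N B T (\<lambda>t. \<Sum>i\<in>UNIV. c $ i * u i t) (\<lambda>t. \<Sum>i\<in>UNIV. c $ i *\<^sub>R \<xi> i t)"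
      using is_response_sum[of UNIV N B T u \<xi>] \<xi> by simp
    ultimately show "\<exists>u \<xi>. smooth_on {0..T} u \<and> is_response N B T u \<xi> \<and> \<xi> T = y"
      using c by (intro exI conjI)
  qed
qed

section \<open>The end-point map and its derivative\<close>

text \<open>The linearization error is small uniformly over base points in a compact set: the Jacobian is
uniformly continuous on a ball that contains a neighbourhood of the set. It is applied to the
image of a trajectory, where it makes the error small at all times simultaneously.\<close>
lemma uniform_linearization:
  fixes f :: "real^'n \<Rightarrow> real^'n" and J :: "real^'n \<Rightarrow> real^'n^'n"
  assumes der: "\<And>x. (f has_derivative (\<lambda>v. J x *v v)) (at x)"
    and J: "continuous_on UNIV J" and "compact S" and "0 < \<epsilon>"
  obtains \<delta> where "0 < \<delta>" "\<And>x y. x \<in> S \<Longrightarrow> norm (y - x) < \<delta> \<Longrightarrow>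
    norm (f y - f x - J x *v (y - x)) \<le> \<epsilon> * norm (y - x)"
proof -
  obtain r where r: "\<And>x. x \<in> S \<Longrightarrow> norm x \<le> r"
    using compact_imp_bounded[OF \<open>compact S\<close>] by (auto simp: bounded_iff)
  define n where "n = real CARD('n)"
  have n: "0 < n" by (simp add: n_def)
  have "uniformly_continuous_on (cball 0 (r + 1)) J"
    by (intro compact_uniformly_continuous continuous_on_subset[OF J]) auto
  moreover have "0 < \<epsilon> / (n * n)" using n \<open>0 < \<epsilon>\<close> by simp
  ultimately obtain d where "0 < d" and d: "\<And>x y. x \<in> cball 0 (r + 1) \<Longrightarrow> y \<in> cball 0 (r + 1) \<Longrightarrow>
      dist y x < d \<Longrightarrow> dist (J y) (J x) < \<epsilon> / (n * n)"
    unfolding uniformly_continuous_on_def by metis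
  show thesis
  proof (rule that[of "min d 1"])
    show "0 < min d 1" using \<open>0 < d\<close> by simp
    fix x y assume x: "x \<in> S" and y: "norm (y - x) < min d 1"
    let ?B = "ball x (min d 1)"
    have "norm (f y - f x - J x *v (y - x)) \<le> norm (y - x) * \<epsilon>"
    proof (rule differentiable_bound_linearization[where S = ?B and f' = "\<lambda>x v. J x *v v"])
      show "x \<in> ?B" using \<open>0 < d\<close> by simp
      show "x + t *\<^sub>R (y - x) \<in> ?B" if "t \<in> {0..1}" for t
      proof -
        have "t * norm (y - x) \<le> 1 * norm (y - x)"
          using that by (intro mult_right_mono) auto
        then have "t * norm (y - x) < min d 1" using y by linarith
        then show ?thesis using that by (simp add: dist_norm)
      qed
      show "(f has_derivative (*v) (J z)) (at z within ?B)" for z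
        using der has_derivative_at_withinI by blast
      show "onorm ((*v) (J z) - (*v) (J x)) \<le> \<epsilon>" if z: "z \<in> ?B" for z
      proof -
        have "norm z \<le> norm x + dist x z"
          using norm_triangle_sub[of z x] by (simp add: dist_norm norm_minus_commute)
        then have "dist (J z) (J x) < \<epsilon> / (n * n)"
          using r[OF x] z by (intro d) (auto simp: dist_commute)
        then have "\<bar>(J z - J x) $ i $ j\<bar> \<le> \<epsilon> / (n * n)" for i j
          using component_le_norm_cart[of "(J z - J x) $ i" j] Finite_Cartesian_Product.norm_nth_le[of "J z - J x" i]
          by (simp add: dist_norm)
        then have "onorm ((*v) (J z - J x)) \<le> n * n * (\<epsilon> / (n * n))"
          unfolding n_def by (rule onorm_le_matrix_component)
        moreover have "(*v) (J z) - (*v) (J x) = (*v) (J z - J x)"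
          by (simp add: fun_eq_iff matrix_vector_mult_diff_rdistrib)
        ultimately show ?thesis using n by simp
      qed
    qed
    then show "norm (f y - f x - J x *v (y - x)) \<le> \<epsilon> * norm (y - x)"
      by (simp add: mult.commute)
  qed
qed

lemma smooth_on_jacobian:
  fixes f :: "real^'n \<Rightarrow> real^'m"
  assumes "smooth_on UNIV f"
  shows "(f has_derivative (\<lambda>v. jacobian f (at x) *v v)) (at x)"
    and "continuous_on UNIV (\<lambda>x. jacobian f (at x))"
proof -
  have C1: "Ck_on (Suc 0) UNIV f" using assms unfolding smooth_on_def by blast
  then show "(f has_derivative (\<lambda>v. jacobian f (at x) *v v)) (at x)"
    by (simp add: differentiable_on_def flip: jacobian_works)
  show "continuous_on UNIV (\<lambda>x. jacobian f (at x))"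
    unfolding jacobian_def matrix_def using C1 by (auto intro!: continuous_intros)
qed

text \<open>A bounded Jacobian makes the right-hand side globally Lipschitz, so that trajectories neither blow
up nor branch.\<close>
locale lipschitz_system =
  fixes A :: "real^'n^'n" and B :: "real^'n" and f :: "real^'n \<Rightarrow> real^'n"
    and J :: "real^'n \<Rightarrow> real^'n^'n" and \<kappa> T :: real and x0 :: "real^'n"
  assumes T: "0 < T"
    and der: "\<And>x. (f has_derivative (\<lambda>v. J x *v v)) (at x)"
    and contJ: "continuous_on UNIV J"
    and J: "\<And>x. onorm ((*v) (J x)) \<le> \<kappa>"
begin

definition "K = onorm ((*v) A) + \<kappa>"

lemma K_nonneg: "0 \<le> K"
  using order_trans[OF onorm_pos_le[OF matrix_vector_mul_bounded_linear] J]
    onorm_pos_le[OF matrix_vector_mul_bounded_linear, of A] by (simp add: K_def)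

lemma lipschitz: "norm ((A *v x + f x) - (A *v y + f y)) \<le> K * norm (x - y)"
proof -
  have "norm (f x - f y) \<le> \<kappa> * norm (x - y)"
    using der J by (intro differentiable_bound[of UNIV f "\<lambda>x v. J x *v v"]) auto
  moreover have eq: "(A *v x + f x) - (A *v y + f y) = A *v (x - y) + (f x - f y)"
    by (simp add: matrix_vector_mult_diff_distrib)
  ultimately show ?thesis
    unfolding eq K_def distrib_right
    using norm_triangle_ineq[of "A *v (x - y)" "f x - f y"] norm_matrix_vector_le[of A "x - y"]
    by linarith
qed

lemma continuous_f: "continuous_on S f"
  using der has_derivative_continuous continuous_at_imp_continuous_on by blast

lemma trajectory_exists:
  assumes "continuous_on {0..T} w"
  obtains x where "is_trajectory A B f T w x0 x"
proof -
  have "norm ((A *v x + w t *\<^sub>R B + f x) - (A *v y + w t *\<^sub>R B + f y)) \<le> K * norm (x - y)" for t x y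
    using lipschitz[of x y] by (simp add: algebra_simps)
  moreover have "continuous_on {0..T} (\<lambda>t. A *v x t + w t *\<^sub>R B + f (x t))"
    if "continuous_on {0..T} x" for x
    by (intro continuous_intros assms that continuous_on_compose2[OF continuous_f that]) auto
  ultimately obtain x where "x 0 = x0"
    "\<forall>t\<in>{0..T}. (x has_vector_derivative (A *v x t + w t *\<^sub>R B + f (x t))) (at t within {0..T})"
    by (rule lipschitz_ode_exists[OF less_imp_le[OF T] K_nonneg,
          of "\<lambda>t x. A *v x + w t *\<^sub>R B + f x" x0])
  then show thesis
    by (intro that[of x]) (simp add: is_trajectory_def)
qed

lemma trajectory_unique:
  assumes "is_trajectory A B f T w x0 x" "is_trajectory A B f T w x0 y" "t \<in> {0..T}"
  shows "x t = y t"
proof (rule lipschitz_ode_unique[of K T "\<lambda>t x. A *v x + w t *\<^sub>R B + f x"])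
  show "norm ((A *v x + w t *\<^sub>R B + f x) - (A *v y + w t *\<^sub>R B + f y)) \<le> K * norm (x - y)" for t x y
    using lipschitz[of x y] by (simp add: algebra_simps)
qed (use assms K_nonneg in \<open>auto simp: is_trajectory_def\<close>)

lemma end_point_unique:
  assumes "is_trajectory A B f T w x0 x"
  shows "is_end_point A B f T w x0 y \<longleftrightarrow> y = x T"
proof
  assume "is_end_point A B f T w x0 y"
  then obtain z where z: "is_trajectory A B f T w x0 z" and "z T = y"
    unfolding is_end_point_def by auto
  then show "y = x T" using trajectory_unique[OF z assms, of T] T by simp
next
  assume "y = x T"
  then show "is_end_point A B f T w x0 y" using assms unfolding is_end_point_def by auto
qed

lemma end_point_eq:
  assumes "is_trajectory A B f T w x0 x"
  shows "end_point A B f T w x0 = x T"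
  unfolding end_point_def by (rule the_equality) (simp_all add: end_point_unique[OF assms])

lemma trajectory_continuous: "is_trajectory A B f T w x0 x \<Longrightarrow> continuous_on {0..T} x"
  unfolding is_trajectory_def continuous_on_eq_continuous_within
  by (auto intro: has_vector_derivative_continuous)

lemma continuous_linearization:
  assumes "is_trajectory A B f T w x0 x"
  shows "continuous_on {0..T} (\<lambda>t. A + J (x t))"
  by (intro continuous_intros continuous_on_compose2[OF contJ trajectory_continuous[OF assms]]) auto

lemma onorm_linearization: "onorm ((*v) (A + J x)) \<le> K"
  using onorm_matrix_add_le[of A "J x"] J[of x] by (simp add: K_def)

text \<open>Let \<open>y\<close> be the trajectory for the control \<open>w + s u\<close>. One Gronwall estimate shows that \<open>y - x\<close> is of
order \<open>s\<close>, uniformly in time. Then \<open>y - x - s \<xi>\<close> solves the variational equation with the linearization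
error of \<open>f\<close> as inhomogeneity, which is at most \<open>\<epsilon> * norm (y - x)\<close>; a second Gronwall estimate makes it
\<open>o(s)\<close>.\<close>
lemma end_point_derivative:
  assumes w: "continuous_on {0..T} w" and u: "continuous_on {0..T} u"
    and x: "is_trajectory A B f T w x0 x"
    and \<xi>: "is_response (\<lambda>t. A + J (x t)) B T u \<xi>"
  shows "((\<lambda>s. end_point A B f T (\<lambda>t. w t + s * u t) x0) has_vector_derivative \<xi> T) (at 0)"
proof -
  let ?V = "\<lambda>s. end_point A B f T (\<lambda>t. w t + s * u t) x0"
  define G where "G = growth K T"
  have G: "0 \<le> G" using growth_nonneg T by (simp add: G_def)
  have "bounded ((\<lambda>t. u t *\<^sub>R B) ` {0..T})"
    by (intro compact_imp_bounded compact_continuous_image continuous_intros u) auto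
  then obtain U where U: "0 < U" "\<And>t. t \<in> {0..T} \<Longrightarrow> norm (u t *\<^sub>R B) \<le> U"
    by (auto simp: bounded_pos)
  have UG: "0 \<le> U * G" using U(1) G by simp
  have "\<exists>d>0. \<forall>s. norm (s - 0) < d \<longrightarrow>
      norm (?V s - ?V 0 - (s - 0) *\<^sub>R \<xi> T) \<le> e * norm (s - 0)" if "0 < e" for e
  proof -
    \<comment> \<open>Both Gronwall estimates contribute a factor \<open>G\<close>, and the control a factor \<open>U\<close>; the summand 1
      only avoids a division by zero.\<close>
    define \<epsilon> where "\<epsilon> = e / (U * G * G + 1)"
    have "0 \<le> U * G * G" using UG G by simp
    then have \<epsilon>: "0 < \<epsilon>" "\<epsilon> * (U * G * G) \<le> e"
      using \<open>0 < e\<close> by (auto simp: \<epsilon>_def field_simps add_nonneg_pos)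
    have "compact (x ` {0..T})"
      by (intro compact_continuous_image trajectory_continuous[OF x]) auto
    then obtain \<delta> where "0 < \<delta>" and \<delta>: "\<And>y z. y \<in> x ` {0..T} \<Longrightarrow> norm (z - y) < \<delta> \<Longrightarrow>
        norm (f z - f y - J y *v (z - y)) \<le> \<epsilon> * norm (z - y)"
      using uniform_linearization[OF der contJ _ \<epsilon>(1)] by metis
    have "norm (?V s - ?V 0 - s *\<^sub>R \<xi> T) \<le> e * \<bar>s\<bar>" if s: "\<bar>s\<bar> < \<delta> / (U * G + 1)" for s
    proof -
      have "continuous_on {0..T} (\<lambda>t. w t + s * u t)"
        by (intro continuous_intros w u)
      then obtain y where y: "is_trajectory A B f T (\<lambda>t. w t + s * u t) x0 y"
        by (rule trajectory_exists)
      have close: "norm (y t - x t) \<le> (\<bar>s\<bar> * U) * G" if t: "t \<in> {0..T}" for t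
        unfolding G_def
      proof (rule growth_bound[OF _ K_nonneg _ _ _ t])
        let ?d = "\<lambda>t. ((A *v y t + f (y t)) - (A *v x t + f (x t))) + s *\<^sub>R (u t *\<^sub>R B)"
        show "((\<lambda>t. y t - x t) has_vector_derivative ?d t) (at t within {0..T})"
          if "t \<in> {0..T}" for t
        proof -
          have "((\<lambda>t. y t - x t) has_vector_derivative
              (A *v y t + (w t + s * u t) *\<^sub>R B + f (y t)) - (A *v x t + w t *\<^sub>R B + f (x t)))
              (at t within {0..T})"
            using x y that by (intro has_vector_derivative_diff) (auto simp: is_trajectory_def)
          then show ?thesis by (simp add: algebra_simps)
        qed
        show "norm (?d t) \<le> K * norm (y t - x t) + \<bar>s\<bar> * U" if "t \<in> {0..T}" for t
        proof -
          have "norm (s *\<^sub>R (u t *\<^sub>R B)) \<le> \<bar>s\<bar> * U"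
            unfolding norm_scaleR[of s] by (intro mult_left_mono U(2) that) simp
          then show ?thesis
            using norm_triangle_ineq[of "(A *v y t + f (y t)) - (A *v x t + f (x t))"
                "s *\<^sub>R (u t *\<^sub>R B)"] lipschitz[of "y t" "x t"] by linarith
        qed
      qed (use U(1) x y in \<open>auto simp: is_trajectory_def\<close>)
      have "norm (y T - x T - s *\<^sub>R \<xi> T) \<le> (\<epsilon> * (\<bar>s\<bar> * U * G)) * G"
        unfolding G_def
      proof (rule growth_bound[of "\<lambda>t. y t - x t - s *\<^sub>R \<xi> t", OF _ K_nonneg])
        let ?z = "\<lambda>t. y t - x t - s *\<^sub>R \<xi> t"
        let ?r = "\<lambda>t. f (y t) - f (x t) - J (x t) *v (y t - x t)"
        let ?d = "\<lambda>t. (A + J (x t)) *v ?z t + ?r t"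
        show "(?z has_vector_derivative ?d t) (at t within {0..T})" if "t \<in> {0..T}" for t
        proof -
          have "(?z has_vector_derivative
              (A *v y t + (w t + s * u t) *\<^sub>R B + f (y t)) - (A *v x t + w t *\<^sub>R B + f (x t))
              - s *\<^sub>R ((A + J (x t)) *v \<xi> t + u t *\<^sub>R B)) (at t within {0..T})"
            using x y \<xi> that
            by (intro has_vector_derivative_diff bounded_linear.has_vector_derivative
                [OF bounded_linear_scaleR_right])
              (auto simp: is_trajectory_def is_response_def)
          then show ?thesis
            by (simp add: algebra_simps matrix_vector_mult_add_rdistrib)
        qed
        show "norm (?d t) \<le> K * norm (?z t) + \<epsilon> * (\<bar>s\<bar> * U * growth K T)" if t: "t \<in> {0..T}" for t
        proof -
          have "\<bar>s\<bar> * (U * G) \<le> \<bar>s\<bar> * (U * G + 1)" by (intro mult_left_mono) auto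
          also have "\<dots> < \<delta>"
            using s UG by (simp add: pos_less_divide_eq)
          finally have "norm (y t - x t) < \<delta>"
            using close[OF t] by (simp add: mult.assoc)
          then have "norm (?r t) \<le> \<epsilon> * norm (y t - x t)"
            using t by (intro \<delta>) auto
          also have "\<dots> \<le> \<epsilon> * (\<bar>s\<bar> * U * G)"
            using close[OF t] \<epsilon>(1) by (intro mult_left_mono) auto
          finally have "norm (?r t) \<le> \<epsilon> * (\<bar>s\<bar> * U * growth K T)" by (simp add: G_def)
          moreover have "norm ((A + J (x t)) *v ?z t) \<le> K * norm (?z t)"
            by (intro order_trans[OF norm_matrix_vector_le] mult_right_mono onorm_linearization) simp
          ultimately show ?thesis
            using norm_triangle_ineq[of "(A + J (x t)) *v ?z t" "?r t"] by linarith
        qed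
        show "0 \<le> \<epsilon> * (\<bar>s\<bar> * U * growth K T)"
          using \<epsilon>(1) U(1) G by (simp add: G_def)
      qed (use T x y \<xi> in \<open>auto simp: is_trajectory_def is_response_def\<close>)
      also have "\<dots> = (\<epsilon> * (U * G * G)) * \<bar>s\<bar>" by (simp add: mult_ac)
      also have "\<dots> \<le> e * \<bar>s\<bar>" using \<epsilon>(2) by (intro mult_right_mono) auto
      finally show ?thesis
        using end_point_eq[OF y] end_point_eq[OF x] by simp
    qed
    moreover have "0 < \<delta> / (U * G + 1)" using \<open>0 < \<delta>\<close> UG by (simp add: add_nonneg_pos)
    ultimately show ?thesis
      by (intro exI[of _ "\<delta> / (U * G + 1)"]) simp
  qed
  then show ?thesis
    unfolding has_vector_derivative_def has_derivative_at_alt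
    by (auto intro: bounded_linear_scaleR_left)
qed

end

section \<open>Local controllability\<close>

theorem mainTheorem3:
  fixes A :: "real^'n^'n" and B :: "real^'n" and T :: real and e :: "'n \<Rightarrow> nat"
  assumes "CARD('n) > 2"
    and "bij_betw e UNIV {0..<CARD('n)}"
    and "det (kalman_matrix e A B) \<noteq> 0"
    and "T > 0"
  shows "\<exists>\<kappa>>0. \<forall>f :: real^'n \<Rightarrow> real^'n.
           smooth_on UNIV f \<longrightarrow>
           (\<forall>x. onorm (\<lambda>v. jacobian f (at x) *v v) < \<kappa>) \<longrightarrow>
           (\<forall>x0. locally_controllable A B f T x0)"
proof -
  obtain \<kappa> where "0 < \<kappa>" and surj: "\<And>N y. continuous_on {0..T} N \<Longrightarrow>
      (\<And>t. t \<in> {0..T} \<Longrightarrow> onorm ((*v) (N t - A)) \<le> \<kappa>) \<Longrightarrow>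
       \<exists>u \<xi>. smooth_on {0..T} u \<and> is_response N B T u \<xi> \<and> \<xi> T = y"
    by (rule response_surjective[OF \<open>T > 0\<close> assms(3)]) blast
  have "locally_controllable A B f T x0"
    if f: "smooth_on UNIV f" and small: "\<forall>x. onorm (\<lambda>v. jacobian f (at x) *v v) < \<kappa>" for f x0
  proof -
    interpret lipschitz_system A B f "\<lambda>x. jacobian f (at x)" \<kappa> T x0
      using smooth_on_jacobian[OF f] small \<open>T > 0\<close> by unfold_locales (auto intro: less_imp_le)
    show ?thesis
      unfolding locally_controllable_def
    proof (intro conjI allI impI)
      fix w :: "real \<Rightarrow> real" assume w: "smooth_on {0..T} w"
      then obtain x where x: "is_trajectory A B f T w x0 x"
        using trajectory_exists smooth_on_imp_continuous_on by blast
      show "\<exists>!y. is_end_point A B f T w x0 y"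
        by (simp add: end_point_unique[OF x])
      let ?N = "\<lambda>t. A + jacobian f (at (x t))"
      \<comment> \<open>Responses are unique, so the choice does not affect the value, but \<open>L\<close> must be total: for
        a control that has no response it is unspecified.\<close>
      define L where "L u = (SOME \<xi>. is_response ?N B T u \<xi>) T" for u
      have L: "L u = \<xi> T" if "is_response ?N B T u \<xi>" for u and \<xi>
        unfolding L_def
        by (rule is_response_unique[OF onorm_linearization someI[of _ \<xi>] that])
          (use that T in auto)
      have resp: "\<exists>\<xi>. is_response ?N B T u \<xi>" if "smooth_on {0..T} u" for u
        by (rule is_response_exists[OF _ continuous_linearization[OF x]
              smooth_on_imp_continuous_on[OF that] onorm_linearization])
          (use T in auto)
      have "has_end_point_derivative A B f T w x0 L"
        unfolding has_end_point_derivative_def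
      proof (intro conjI allI impI)
        fix u :: "real \<Rightarrow> real" assume u: "smooth_on {0..T} u"
        then obtain \<xi> where \<xi>: "is_response ?N B T u \<xi>" using resp by blast
        show "((\<lambda>s. end_point A B f T (\<lambda>t. w t + s * u t) x0) has_vector_derivative L u) (at 0)"
          unfolding L[OF \<xi>]
          by (intro end_point_derivative[OF _ _ x \<xi>] smooth_on_imp_continuous_on w u)
        fix v :: "real \<Rightarrow> real" and a b :: real assume "smooth_on {0..T} v"
        then obtain \<eta> where \<eta>: "is_response ?N B T v \<eta>" using resp by blast
        show "L (\<lambda>t. a * u t + b * v t) = a *\<^sub>R L u + b *\<^sub>R L v"
          using L[OF is_response_lincomb[OF \<xi> \<eta>, of a b]] L[OF \<xi>] L[OF \<eta>] by simp
      qed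
      moreover have "L ` {u. smooth_on {0..T} u} = UNIV"
      proof (intro equalityI subsetI UNIV_I)
        fix y
        have "onorm ((*v) (?N t - A)) \<le> \<kappa>" for t
          using small by (simp add: less_imp_le)
        then obtain u \<xi> where u: "smooth_on {0..T} u" and \<xi>: "is_response ?N B T u \<xi>" "\<xi> T = y"
          using surj[OF continuous_linearization[OF x]] by metis
        then show "y \<in> L ` {u. smooth_on {0..T} u}"
          using L[OF \<xi>(1)] by (intro image_eqI[of _ _ u]) auto
      qed
      ultimately show "\<exists>L. has_end_point_derivative A B f T w x0 L \<and>
          L ` {u. smooth_on {0..T} u} = UNIV" by blast
    qed
  qed
  then show ?thesis using \<open>0 < \<kappa>\<close> by blast
qed

end
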